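(* Let $X$ and $Y$ be real reflexive Banach spaces and let $K\subset X$ and $\Lambda\subset Y$ be nonempty, bounded, closed and convex subsets. Let $B:X\times Y\to\mathbb{R}$, $\chi:X\times X\to\mathbb{R}$ and $\psi:Y\times Y\to\mathbb{R}$ be functionals such that $B$ satisfies at least one of the conditions (B1), (B2), $\chi$ satisfies at least one of the conditions (X1), (X2), and $\psi$ satisfies at least one of the conditions (P1), (P2) below (any of the eight combinations is allowed). (B1): (i) for each $\lambda\in Y$, the mapping $u\mapsto B(u,\lambda)$ is convex and lower semicontinuous; (ii) for each $u\in X$, the mapping $\lambda\mapsto B(u,\lambda)$ is concave and upper semicontinuous. (B2): (i) for each $\mu\in Y$, the mapping $[u,\lambda]\mapsto 2B(u,\mu)-B(u,\lambda)$ is weakly lower semicontinuous on $X\times Y$; (ii) for each $v\in X$, the mapping $[u,\lambda]\mapsto 2B(v,\lambda)-B(u,\lambda)$ is concave on $X\times Y$. (X1): (i) for each $v\in X$, the mapping $u\mapsto\chi(u,v-u)$ is weakly upper semicontinuous; (ii) for each $u\in X$, the mapping $v\mapsto\chi(u,v)$ is convex; (iii) $\chi(u,0_X)=0$ for all $u\in X$. (X2): (i) $\chi(u,u-v)+\chi(v,v-u)\geq 0$ for all $u,v\in X$; (ii) for each $u,v,w\in X$, the mapping $[0,1]\ni t\mapsto\chi(u+t(v-u),w)$ is continuous at $0_+$; (iii) for each $u\in X$, $v\mapsto\chi(u,v)$ is concave, upper semicontinuous and positive homogeneous; (iv) $\chi(u,0_X)=0$ for all $u\in X$. (P1): (i)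 for each $\mu\in Y$, the mapping $\lambda\mapsto\psi(\lambda,\mu-\lambda)$ is weakly upper semicontinuous; (ii) for each $\lambda\in Y$, the mapping $\mu\mapsto\psi(\lambda,\mu)$ is convex; (iii) $\psi(\lambda,0_Y)=0$ for all $\lambda\in Y$. (P2): (i) $\psi(\lambda,\lambda-\mu)+\psi(\mu,\mu-\lambda)\geq 0$ for all $\lambda,\mu\in Y$; (ii) for each $\lambda,\mu,\sigma\in Y$, the mapping $[0,1]\ni t\mapsto\psi(\lambda+t(\mu-\lambda),\sigma)$ is continuous at $0_+$; (iii) for each $\lambda\in Y$, $\mu\mapsto\psi(\lambda,\mu)$ is concave, upper semicontinuous and positive homogeneous; (iv) $\psi(\lambda,0_Y)=0$ for all $\lambda\in Y$. Then for any pair $(f,g)\in X^\ast\times Y^\ast$ there exists at least one $(u,\lambda)\in K\times\Lambda$ such that $$ \left\{ \begin{array}{ll} B(v,\lambda)-B(u,\lambda)+\chi(u,v-u)\geq\langle f,v-u\rangle, & \forall v\in K,\\ B(u,\lambda)-B(u,\mu)+\psi(\lambda,\mu-\lambda)\geq\langle g,\mu-\lambda\rangle, & \forall \mu\in\Lambda. \end{array} \right. $$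
   Context: $X^\ast$, $Y^\ast$ denote the topological duals of $X$, $Y$, $\langle\cdot,\cdot\rangle$ the corresponding duality pairings, and $0_X$, $0_Y$ the zero elements. Elements of the product space $X\times Y$ are written $[u,\lambda]$. "Weakly" lower/upper semicontinuous means with respect to the weak topology. A function $p$ on a vector space is positive homogeneous if $p(tv)=t\,p(v)$ for all $t>0$ and all $v$. "Continuous at $0_+$" means that the value at $t$ tends to the value at $0$ as $t\to 0$, $t>0$. *)

theory Defs
  imports "HOL-Analysis.Analysis"
begin

definition canonical_embedding ::
  "'a::real_normed_vector \<Rightarrow> (('a \<Rightarrow>\<^sub>L real) \<Rightarrow>\<^sub>L real)" where
  "canonical_embedding x = Blinfun (\<lambda>\<phi>. blinfun_apply \<phi> x)"

lemma blinfun_apply_canonical_embedding: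
  "blinfun_apply (canonical_embedding x) \<phi> = blinfun_apply \<phi> x"
  unfolding canonical_embedding_def
  by (simp add: bounded_linear_Blinfun_apply blinfun.bounded_linear_left)

definition reflexive_space :: "'a::real_normed_vector itself \<Rightarrow> bool" where
  "reflexive_space _ \<longleftrightarrow> surj (canonical_embedding :: 'a \<Rightarrow> _)"

definition weak_topology :: "'a::real_normed_vector topology" where
  "weak_topology =
     topology_generated_by {blinfun_apply \<phi> -` U | (\<phi> :: 'a \<Rightarrow>\<^sub>L real) U. open U}"

lemma topspace_weak_topology: "topspace weak_topology = UNIV"
  unfolding weak_topology_def topology_generated_by_topspace
  by (auto intro!: exI[of _ UNIV])

definition lower_semicontinuous_map :: "'a topology \<Rightarrow> ('a \<Rightarrow> real) \<Rightarrow> bool" where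
  "lower_semicontinuous_map T p \<longleftrightarrow> (\<forall>a. openin T {x \<in> topspace T. a < p x})"

definition upper_semicontinuous_map :: "'a topology \<Rightarrow> ('a \<Rightarrow> real) \<Rightarrow> bool" where
  "upper_semicontinuous_map T p \<longleftrightarrow> (\<forall>a. openin T {x \<in> topspace T. p x < a})"

text \<open>Only positive scalars are allowed: nothing is said about the value at zero.\<close>

definition positive_homogeneous :: "('a::real_vector \<Rightarrow> real) \<Rightarrow> bool" where
  "positive_homogeneous p \<longleftrightarrow> (\<forall>t>0. \<forall>v. p (t *\<^sub>R v) = t * p v)"

definition cond_B1 ::
  "('a::real_normed_vector \<Rightarrow> 'b::real_normed_vector \<Rightarrow> real) \<Rightarrow> bool" where
  "cond_B1 B \<longleftrightarrow>
     (\<forall>lam. convex_on UNIV (\<lambda>u. B u lam) \<and> lower_semicontinuous_map euclidean (\<lambda>u. B u lam)) \<and>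
     (\<forall>u. concave_on UNIV (\<lambda>lam. B u lam) \<and> upper_semicontinuous_map euclidean (\<lambda>lam. B u lam))"

text \<open>The weak topology below is that of the normed product space \<open>X \<times> Y\<close>.\<close>

definition cond_B2 ::
  "('a::real_normed_vector \<Rightarrow> 'b::real_normed_vector \<Rightarrow> real) \<Rightarrow> bool" where
  "cond_B2 B \<longleftrightarrow>
     (\<forall>\<mu>. lower_semicontinuous_map weak_topology (\<lambda>(u, lam). 2 * B u \<mu> - B u lam)) \<and>
     (\<forall>v. concave_on UNIV (\<lambda>(u, lam). 2 * B v lam - B u lam))"

text \<open>(X1) and (P1) are the same condition, imposed on \<open>chi\<close> over \<open>X\<close> and on \<open>\<psi>\<close> over \<open>Y\<close>;
  likewise (X2) and (P2).\<close>

definition cond_XP1 :: "('a::real_normed_vector \<Rightarrow> 'a \<Rightarrow> real) \<Rightarrow> bool" where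
  "cond_XP1 chi \<longleftrightarrow>
     (\<forall>v. upper_semicontinuous_map weak_topology (\<lambda>u. chi u (v - u))) \<and>
     (\<forall>u. convex_on UNIV (\<lambda>v. chi u v)) \<and>
     (\<forall>u. chi u 0 = 0)"

definition cond_XP2 :: "('a::real_normed_vector \<Rightarrow> 'a \<Rightarrow> real) \<Rightarrow> bool" where
  "cond_XP2 chi \<longleftrightarrow>
     (\<forall>u v. chi u (u - v) + chi v (v - u) \<ge> 0) \<and>
     (\<forall>u v w. ((\<lambda>t. chi (u + t *\<^sub>R (v - u)) w) \<longlongrightarrow> chi u w) (at_right (0::real))) \<and>
     (\<forall>u. concave_on UNIV (\<lambda>v. chi u v) \<and>
          upper_semicontinuous_map euclidean (\<lambda>v. chi u v) \<and>
          positive_homogeneous (\<lambda>v. chi u v)) \<and>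
     (\<forall>u. chi u 0 = 0)"

end

theory Submission
  imports Defs
begin

text \<open>
  The linear terms can be absorbed into \<open>B\<close>: replacing \<open>B\<close> by
  \<open>L u lam = B u lam - f u + g lam\<close> keeps all convexity and semicontinuity and reduces the claim to
  \<open>f = 0\<close>, \<open>g = 0\<close>. Moreover condition (B2) implies (B1), as one sees by restricting it to
  the slices \<open>u = const\<close> and \<open>lam = const\<close> (\<open>cond_B2_imp_cond_B1\<close>), so \<open>L\<close> is convex-concave.

  The two inequalities are the two partial cases \<open>\<mu> = lam\<close> and \<open>v = u\<close> of the single inequality
  \<open>0 \<le> L v lam - L u \<mu> + chi u (v - u) + \<psi> lam (\<mu> - lam)\<close> for all \<open>(v, \<mu>) \<in> K \<times> \<Lambda>\<close>,
  in which the coupling term \<open>L u lam\<close>, semicontinuous in no useful sense, has cancelled. A Ky Fan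
  argument on \<open>K \<times> \<Lambda>\<close> needs the right-hand side to be weakly upper semicontinuous in the unknown
  \<open>(u, lam)\<close>. For \<open>L v lam - L u \<mu>\<close> this follows from
  concavity by Mazur's theorem, and (X1) assumes it. Under (X2) the term \<open>chi u (v - u)\<close> is only hemicontinuous in
  \<open>u\<close>, and it is replaced by Minty's term \<open>chi v (v - u)\<close>, which is concave and upper
  semicontinuous in \<open>u\<close>; monotonicity makes the replacement harmless for existence, and
  hemicontinuity together with homogeneity recovers the original inequality afterwards. The lemma
  \<open>Minty_resolvent\<close> treats (X1) and (X2) uniformly, so that the eight cases become one.

  Existence for the combined inequality is \<open>Ky_Fan_weak_product\<close>: by the KKM principle finitely many
  of the solution sets have a common point, and weak compactness of \<open>K \<times> \<Lambda>\<close> passes to all of them.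
  The KKM principle comes from Brouwer's fixed point theorem on cubes of arbitrary dimension, and the
  weak compactness of closed bounded convex sets in a reflexive space from Hahn-Banach separation
  and Tychonoff's theorem.
\<close>

section \<open>Brouwer's theorem and the KKM principle\<close>

text \<open>
  The dimension has to be a number here rather than a type, because the KKM principle is applied to
  finite sets of unknown size. The cube therefore lives in the sequence space, which is metrizable,
  and the coordinates from \<open>n\<close> on are kept at \<open>0\<close>.
\<close>

definition unit_cube_nat :: "nat \<Rightarrow> (nat \<Rightarrow> real) set" where
  "unit_cube_nat n = PiE UNIV (\<lambda>i. if i < n then {0..1} else {0})"

lemma unit_cube_nat_iff:
  "x \<in> unit_cube_nat n \<longleftrightarrow> (\<forall>i<n. 0 \<le> x i \<and> x i \<le> 1) \<and> (\<forall>i\<ge>n. x i = 0)"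
  unfolding unit_cube_nat_def
  by (simp add: PiE_UNIV_domain Pi_iff if_distrib[of "\<lambda>A. _ \<in> A"] not_less[symmetric]
      all_conj_distrib if_bool_eq_conj cong: if_cong)

lemma compact_unit_cube_nat: "compact (unit_cube_nat n)"
proof -
  have "compactin (product_topology (\<lambda>_. euclideanreal) UNIV) (unit_cube_nat n)"
    unfolding unit_cube_nat_def by (subst compactin_PiE) auto
  then show ?thesis
    by (simp add: euclidean_product_topology)
qed

text \<open>
  Label the coordinate \<open>i\<close> of a grid point by \<open>0\<close> or \<open>1\<close> according to whether \<open>f\<close> moves the point up
  or down in that coordinate. Kuhn's combinatorial lemma yields a grid cell that shows both labels in
  every coordinate. As the mesh tends to zero, a subsequence of these cells shrinks to a point \<open>w\<close>,
  and continuity of each \<open>f _ i\<close> gives both \<open>w i \<le> f w i\<close> and \<open>f w i \<le> w i\<close>.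
\<close>

lemma Brouwer_unit_cube_nat:
  fixes f :: "(nat \<Rightarrow> real) \<Rightarrow> nat \<Rightarrow> real"
  assumes cont: "\<And>i. continuous_on (unit_cube_nat n) (\<lambda>x. f x i)"
    and maps: "\<And>x. x \<in> unit_cube_nat n \<Longrightarrow> f x \<in> unit_cube_nat n"
  shows "\<exists>x\<in>unit_cube_nat n. f x = x"
proof -
  let ?Q = "unit_cube_nat n"
  have "\<forall>x. x \<in> ?Q \<longrightarrow> f x \<in> ?Q"
    and "\<forall>x. x \<in> ?Q \<longrightarrow> (\<forall>i. i < n \<longrightarrow> 0 \<le> x i \<and> x i \<le> 1)"
    using maps by (auto simp: unit_cube_nat_iff)
  note labelling = kuhn_labelling_lemma'[of "\<lambda>x. x \<in> ?Q" f "\<lambda>i. i < n", OF this]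
  obtain l :: "(nat \<Rightarrow> real) \<Rightarrow> nat \<Rightarrow> nat" where
    l_le: "\<And>x i. l x i \<le> 1"
    and l0: "\<And>x i. x \<in> ?Q \<Longrightarrow> i < n \<Longrightarrow> x i = 0 \<Longrightarrow> l x i = 0"
    and l1: "\<And>x i. x \<in> ?Q \<Longrightarrow> i < n \<Longrightarrow> x i = 1 \<Longrightarrow> l x i = 1"
    and l0_le: "\<And>x i. x \<in> ?Q \<Longrightarrow> i < n \<Longrightarrow> l x i = 0 \<Longrightarrow> x i \<le> f x i"
    and l1_ge: "\<And>x i. x \<in> ?Q \<Longrightarrow> i < n \<Longrightarrow> l x i = 1 \<Longrightarrow> f x i \<le> x i"
    using labelling by blast
  define near where "near k z x \<longleftrightarrow> x \<in> ?Q \<and> (\<forall>j. \<bar>x j - z j\<bar> \<le> 1 / real (Suc k))"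
    for k and z x :: "nat \<Rightarrow> real"
  have approx: "\<exists>z. z \<in> ?Q \<and>
      (\<forall>i<n. (\<exists>x. near k z x \<and> x i \<le> f x i) \<and> (\<exists>y. near k z y \<and> f y i \<le> y i))" for k
  proof -
    define P where "P = Suc k"
    define grid where "grid q = (\<lambda>j. if j < n then real (q j) / real P else 0)"
      for q :: "nat \<Rightarrow> nat"
    have P: "0 < P" by (simp add: P_def)
    have grid_in: "grid q \<in> ?Q" if "\<And>j. j < n \<Longrightarrow> q j \<le> P" for q
      using that P by (auto simp: unit_cube_nat_iff grid_def divide_simps)
    have 1: "\<forall>x. (\<forall>i<n. x i \<le> P) \<longrightarrow> (\<forall>i<n. l (grid x) i = 0 \<or> l (grid x) i = 1)"
      using l_le by (metis le_neq_implies_less less_one)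
    have 2: "\<forall>x. (\<forall>i<n. x i \<le> P) \<longrightarrow> (\<forall>i<n. x i = 0 \<longrightarrow> l (grid x) i = 0)"
      using l0[OF grid_in] by (simp add: grid_def)
    have 3: "\<forall>x. (\<forall>i<n. x i \<le> P) \<longrightarrow> (\<forall>i<n. x i = P \<longrightarrow> l (grid x) i = 1)"
      using l1[OF grid_in] P by (simp add: grid_def)
    obtain q where q: "\<forall>i<n. q i < P" and rs: "\<forall>i<n. \<exists>r s.
        (\<forall>j<n. q j \<le> r j \<and> r j \<le> q j + 1) \<and> (\<forall>j<n. q j \<le> s j \<and> s j \<le> q j + 1) \<and>
        l (grid r) i \<noteq> l (grid s) i"
      using kuhn_lemma[OF P 1 2 3] by blast
    have near_grid: "near k (grid q) (grid r)"
      if r: "\<forall>j<n. q j \<le> r j \<and> r j \<le> q j + 1" for r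
      unfolding near_def
    proof
      show "grid r \<in> ?Q"
        using r q by (intro grid_in) fastforce
      show "\<forall>j. \<bar>grid r j - grid q j\<bar> \<le> 1 / real (Suc k)"
      proof
        fix j
        have "\<bar>real (r j) - real (q j)\<bar> \<le> 1" if "j < n"
          using r that by force
        then show "\<bar>grid r j - grid q j\<bar> \<le> 1 / real (Suc k)"
          by (auto simp: grid_def P_def diff_divide_distrib[symmetric] divide_right_mono)
      qed
    qed
    show ?thesis
    proof (rule exI[of _ "grid q"], intro conjI allI impI)
      show "grid q \<in> ?Q"
        using near_grid[of q] by (simp add: near_def)
      fix i assume i: "i < n"
      obtain r s where r: "\<forall>j<n. q j \<le> r j \<and> r j \<le> q j + 1"
        and s: "\<forall>j<n. q j \<le> s j \<and> s j \<le> q j + 1" and neq: "l (grid r) i \<noteq> l (grid s) i"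
        using rs i by blast
      have "l (grid r) i = 0 \<and> l (grid s) i = 1 \<or> l (grid r) i = 1 \<and> l (grid s) i = 0"
        using neq l_le[of "grid r" i] l_le[of "grid s" i] by linarith
      then obtain x y where xy: "near k (grid q) x" "near k (grid q) y" "l x i = 0" "l y i = 1"
        using near_grid[OF r] near_grid[OF s] by blast
      then have "x \<in> ?Q" "y \<in> ?Q"
        by (simp_all add: near_def)
      then have "x i \<le> f x i" "f y i \<le> y i"
        using l0_le[of x i] l1_ge[of y i] xy i by simp_all
      then show "\<exists>x. near k (grid q) x \<and> x i \<le> f x i" "\<exists>y. near k (grid q) y \<and> f y i \<le> y i"
        using xy by (auto intro: exI[of _ x] exI[of _ y])
    qed
  qed
  define z where "z k = (SOME z. z \<in> ?Q \<and>
      (\<forall>i<n. (\<exists>x. near k z x \<and> x i \<le> f x i) \<and> (\<exists>y. near k z y \<and> f y i \<le> y i)))" for k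
  note z_spec = someI_ex[OF approx, folded z_def]
  have z: "z k \<in> ?Q" for k
    using z_spec[of k] by simp
  have below: "\<exists>x. near k (z k) x \<and> x i \<le> f x i" and above: "\<exists>y. near k (z k) y \<and> f y i \<le> y i"
    if "i < n" for k i
    using z_spec[of k] that by simp_all
  obtain w \<rho> where w: "w \<in> ?Q" and \<rho>: "strict_mono \<rho>" and lim: "(z \<circ> \<rho>) \<longlonglongrightarrow> w"
    using seq_compactE[OF compact_imp_seq_compact[OF compact_unit_cube_nat[of n]], of z] z by blast
  have small: "(\<lambda>k. 1 / real (Suc (\<rho> k))) \<longlonglongrightarrow> 0"
    using LIMSEQ_subseq_LIMSEQ[OF LIMSEQ_Suc[OF lim_1_over_n] \<rho>] by (simp add: o_def)
  have lim_coord: "(\<lambda>k. z (\<rho> k) j) \<longlonglongrightarrow> w j" for j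
    using continuous_on_tendsto_compose[OF continuous_on_product_coordinates[of j] lim] by (simp add: o_def)
  have near_lim: "(\<lambda>k. f (x k) i) \<longlonglongrightarrow> f w i \<and> (\<lambda>k. x k i) \<longlonglongrightarrow> w i"
    if "\<And>k. near (\<rho> k) (z (\<rho> k)) (x k)" for x i
  proof -
    have xQ: "x k \<in> ?Q" and xz: "\<bar>x k j - z (\<rho> k) j\<bar> \<le> 1 / real (Suc (\<rho> k))" for k j
      using that[of k] by (simp_all add: near_def)
    have xj: "(\<lambda>k. x k j) \<longlonglongrightarrow> w j" for j
    proof -
      have "(\<lambda>k. x k j - z (\<rho> k) j) \<longlonglongrightarrow> 0"
        by (rule Lim_null_comparison[OF _ small]) (use xz in simp)
      from tendsto_add[OF this lim_coord[of j]] show ?thesis by simp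
    qed
    have "limitin (product_topology (\<lambda>_. euclideanreal) UNIV) x w sequentially"
      using xj by (simp add: limitin_componentwise)
    then have "x \<longlonglongrightarrow> w"
      by (simp add: euclidean_product_topology)
    then have "(\<lambda>k. f (x k) i) \<longlonglongrightarrow> f w i"
      using continuous_on_tendsto_compose[OF cont[of i] _ w, of x sequentially] xQ by simp
    with xj show ?thesis by simp
  qed
  have inside: "f w i = w i" if i: "i < n" for i
  proof -
    define x where "x k = (SOME x. near k (z k) x \<and> x i \<le> f x i)" for k
    have x: "near k (z k) (x k)" "x k i \<le> f (x k) i" for k
      using someI_ex[OF below[OF i, of k], folded x_def] by simp_all
    define y where "y k = (SOME y. near k (z k) y \<and> f y i \<le> y i)" for k
    have y: "near k (z k) (y k)" "f (y k) i \<le> y k i" for k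
      using someI_ex[OF above[OF i, of k], folded y_def] by simp_all
    have "w i \<le> f w i"
      using near_lim[of "\<lambda>k. x (\<rho> k)" i] x
      by (intro LIMSEQ_le[of "\<lambda>k. x (\<rho> k) i" _ "\<lambda>k. f (x (\<rho> k)) i"]) simp_all
    moreover have "f w i \<le> w i"
      using near_lim[of "\<lambda>k. y (\<rho> k)" i] y
      by (intro LIMSEQ_le[of "\<lambda>k. f (y (\<rho> k)) i" _ "\<lambda>k. y (\<rho> k) i"]) simp_all
    ultimately show ?thesis by simp
  qed
  have "f w = w"
  proof
    fix i
    show "f w i = w i"
    proof (cases "i < n")
      case True
      then show ?thesis by (rule inside)
    next
      case False
      then show ?thesis
        using maps[OF w] w by (simp add: unit_cube_nat_iff)
    qed
  qed
  from bexI[of "\<lambda>x. f x = x", OF this w] show ?thesis .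
qed

text \<open>
  Suppose that the sets \<open>C a\<close> have no common point in the convex hull. Then the distances to the sets
  \<open>C a\<close>, cut down to the hull, do not vanish simultaneously, and after division by their sum they are
  the barycentric coordinates of a continuous self-map. Its fixed point \<open>x\<close> is a convex combination
  of vertices \<open>a\<close> from whose sets \<open>C a\<close> the point has positive distance, which contradicts the
  covering hypothesis for the face spanned by these vertices.
\<close>

lemma KKM:
  fixes A :: "'a::real_normed_vector set" and C :: "'a \<Rightarrow> 'a set"
  assumes A: "finite A" "A \<noteq> {}"
    and closed: "\<And>a. a \<in> A \<Longrightarrow> closed (C a)"
    and cover: "\<And>S. S \<subseteq> A \<Longrightarrow> S \<noteq> {} \<Longrightarrow> convex hull S \<subseteq> (\<Union>a\<in>S. C a)"
  shows "\<exists>x\<in>convex hull A. \<forall>a\<in>A. x \<in> C a"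
proof (rule ccontr)
  assume none: "\<not> ?thesis"
  obtain e where e: "bij_betw e {..<card A} A"
    using ex_bij_betw_nat_finite[OF A(1)] by (auto simp: atLeast0LessThan)
  define n where "n = card A"
  define D where "D i = C (e i) \<inter> convex hull A" for i
  have eA: "e i \<in> A" if "i < n" for i
    using e that by (auto simp: bij_betw_def n_def)
  have D_closed: "closed (D i)" if "i < n" for i
    using closed[OF eA[OF that]] finite_imp_compact_convex_hull[OF A(1)]
    by (auto simp: D_def intro: compact_imp_closed)
  have D_nonempty: "D i \<noteq> {}" if "i < n" for i
    using cover[of "{e i}"] eA[OF that] hull_inc[of "e i" A convex] by (auto simp: D_def)
  \<comment> \<open>The coefficients need not sum to one: the sets \<open>D i\<close> have no common point anywhere, so \<open>g\<close> is
    defined on the whole cube, and only its fixed point has to lie in the simplex.\<close>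
  define comb where "comb x = (\<Sum>i<n. x i *\<^sub>R e i)" for x :: "nat \<Rightarrow> real"
  define p where "p x i = infdist (comb x) (D i)" for x i
  have p0: "0 \<le> p x i" for x i
    by (simp add: p_def infdist_nonneg)
  have p_zero: "comb x \<in> D i" if "p x i = 0" "i < n" for x i
    using that in_closed_iff_infdist_zero[OF D_closed D_nonempty] by (simp add: p_def)
  have n: "0 < n" using A by (simp add: n_def card_gt_0_iff)
  have pos: "0 < (\<Sum>i<n. p x i)" for x
  proof (rule ccontr)
    assume "\<not> ?thesis"
    then have "(\<Sum>i<n. p x i) = 0"
      by (simp add: antisym p0 sum_nonneg)
    then have "\<forall>i<n. p x i = 0"
      by (subst (asm) sum_nonneg_eq_0_iff) (auto simp: p0)
    then have all: "comb x \<in> D i" if "i < n" for i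
      using p_zero that by blast
    have "comb x \<in> C a" if "a \<in> A" for a
    proof -
      obtain i where "i < n" "a = e i"
        using e \<open>a \<in> A\<close> unfolding bij_betw_def n_def by (metis imageE lessThan_iff)
      then show ?thesis
        using all by (simp add: D_def)
    qed
    moreover have "comb x \<in> convex hull A"
      using all[OF n] by (simp add: D_def)
    ultimately show False using none by blast
  qed
  define g where "g x i = (if i < n then p x i / (\<Sum>j<n. p x j) else 0)" for x i
  have cont_comb: "continuous_on S comb" for S
    unfolding comb_def
    by (intro continuous_intros continuous_on_subset[OF continuous_on_product_coordinates]) auto
  have cont_p: "continuous_on S (\<lambda>x. p x i)" for S i
    unfolding p_def by (intro continuous_on_infdist cont_comb)
  have cont_g: "continuous_on S (\<lambda>x. g x i)" for S i
  proof (cases "i < n")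
    case True
    have "(\<Sum>j<n. p x j) \<noteq> 0" for x using pos[of x] by simp
    with True show ?thesis
      unfolding g_def by (simp add: continuous_on_divide continuous_on_sum cont_p)
  qed (simp add: g_def)
  have "g x \<in> unit_cube_nat n" for x
    using pos[of x] p0 member_le_sum[of _ "{..<n}" "p x"]
    by (auto simp: unit_cube_nat_iff g_def)
  then obtain x where x: "x \<in> unit_cube_nat n" and fixpt: "g x = x"
    using Brouwer_unit_cube_nat[of n g] cont_g by blast
  have x0: "0 \<le> x i" if "i < n" for i
    using x that by (simp add: unit_cube_nat_iff)
  have "(\<Sum>i<n. g x i) = 1"
    using pos[of x] by (simp add: g_def sum_divide_distrib[symmetric])
  then have sum1: "(\<Sum>i<n. x i) = 1"
    by (simp add: fixpt)
  \<comment> \<open>The face that carries the fixed point.\<close>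
  define I where "I = {i. i < n \<and> x i > 0}"
  have sub: "(\<Sum>i\<in>I. h i) = (\<Sum>i<n. h i)" if "\<And>i. x i = 0 \<Longrightarrow> h i = 0" for h :: "nat \<Rightarrow> 'b::comm_monoid_add"
    by (rule sum.mono_neutral_left) (use x0 that in \<open>force simp: I_def\<close>)+
  have "(\<Sum>i\<in>I. x i) = 1" using sub[of x] sum1 by simp
  moreover have "comb x = (\<Sum>i\<in>I. x i *\<^sub>R e i)"
    unfolding comb_def by (rule sub[symmetric]) simp
  moreover have "finite I" by (simp add: I_def)
  ultimately have "comb x \<in> convex hull (e ` I)"
    using convex_sum[OF _ convex_convex_hull, of I x e "e ` I"] x0 by (auto simp: I_def hull_inc)
  moreover have "I \<noteq> {}" using \<open>(\<Sum>i\<in>I. x i) = 1\<close> by auto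
  moreover have "e ` I \<subseteq> A" using eA by (auto simp: I_def)
  ultimately obtain i where i: "i \<in> I" "comb x \<in> C (e i)"
    using cover[of "e ` I"] by blast
  have "comb x \<in> convex hull A"
    using \<open>comb x \<in> convex hull (e ` I)\<close> hull_mono[OF \<open>e ` I \<subseteq> A\<close>] by blast
  then have "p x i = 0"
    using i by (simp add: p_def D_def)
  then have "x i = 0"
    using fixpt i by (metis (no_types, lifting) div_0 g_def)
  then show False
    using i by (simp add: I_def)
qed

section \<open>Hahn-Banach separation\<close>

definition sublinear :: "('a::real_vector \<Rightarrow> real) \<Rightarrow> bool" where
  "sublinear p \<longleftrightarrow> (\<forall>x y. p (x + y) \<le> p x + p y) \<and> (\<forall>t\<ge>0. \<forall>x. p (t *\<^sub>R x) = t * p x)"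

lemma sublinear_add: "sublinear p \<Longrightarrow> p (x + y) \<le> p x + p y"
  by (simp add: sublinear_def)

lemma sublinear_scale: "sublinear p \<Longrightarrow> 0 \<le> t \<Longrightarrow> p (t *\<^sub>R x) = t * p x"
  by (simp add: sublinear_def)

lemma sublinear_zero: "sublinear p \<Longrightarrow> p 0 = 0"
  using sublinear_scale[of p 0 0] by simp

lemma sublinear_ge_minus: "sublinear p \<Longrightarrow> - p (- x) \<le> p x"
  using sublinear_add[of p x "- x"] sublinear_zero[of p] by simp

lemma sublinear_of_pos:
  assumes add: "\<And>x y. p (x + y) \<le> p x + p y" and zero: "p 0 = 0"
    and scale: "\<And>t x. 0 < t \<Longrightarrow> p (t *\<^sub>R x) \<le> t * p x"
  shows "sublinear p"
  unfolding sublinear_def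
proof (intro conjI allI impI add)
  fix t :: real and x assume "0 \<le> t"
  show "p (t *\<^sub>R x) = t * p x"
  proof (cases "t = 0")
    case False
    with \<open>0 \<le> t\<close> have t: "0 < t" by simp
    have "p x \<le> inverse t * p (t *\<^sub>R x)"
      using scale[of "inverse t" "t *\<^sub>R x"] t by simp
    then have "t * p x \<le> p (t *\<^sub>R x)"
      using t by (simp add: field_simps)
    with scale[OF t] show ?thesis by (simp add: antisym)
  qed (simp add: zero)
qed

text \<open>
  This is the one construction behind both the linearity of minimal sublinear functionals
  (\<open>C\<close> a singleton) and the separation of a point from a convex set (\<open>p\<close> the norm). The functional
  \<open>q v = (INF t\<ge>0. INF c\<in>C. p (v + t c) - t d)\<close> is bounded below because \<open>d \<le> p\<close> on \<open>C\<close>, is subadditive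
  because \<open>C\<close> is convex, and satisfies \<open>q \<le> p\<close> by the choice \<open>t = 0\<close> and \<open>q (- c) \<le> - d\<close> by the
  choice \<open>t = 1\<close>.
\<close>

lemma sublinear_reduction:
  assumes p: "sublinear p" and C: "convex C" "C \<noteq> {}" and d: "\<And>c. c \<in> C \<Longrightarrow> d \<le> p c"
  obtains q where "sublinear q" "\<And>v. q v \<le> p v" "\<And>c. c \<in> C \<Longrightarrow> q (- c) \<le> - d"
proof -
  define V where "V v = {p (v + t *\<^sub>R c) - t * d | t c. 0 \<le> t \<and> c \<in> C}" for v
  define q where "q v = Inf (V v)" for v
  have low: "- p (- v) \<le> r" if "r \<in> V v" for v r
  proof -
    obtain t c where tc: "0 \<le> t" "c \<in> C" "r = p (v + t *\<^sub>R c) - t * d"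
      using \<open>r \<in> V v\<close> by (auto simp: V_def)
    have "t * d \<le> t * p c"
      using d tc by (simp add: mult_left_mono)
    also have "\<dots> = p ((v + t *\<^sub>R c) + - v)"
      using sublinear_scale[OF p] tc by simp
    also have "\<dots> \<le> p (v + t *\<^sub>R c) + p (- v)"
      by (rule sublinear_add[OF p])
    finally show ?thesis
      using tc by simp
  qed
  have bdd: "bdd_below (V v)" for v
    using low by (meson bdd_below.I)
  have mem: "p (v + t *\<^sub>R c) - t * d \<in> V v" if "0 \<le> t" "c \<in> C" for v t c
    using that by (auto simp: V_def)
  have le: "q v \<le> p (v + t *\<^sub>R c) - t * d" if "0 \<le> t" "c \<in> C" for v t c
    unfolding q_def by (rule cInf_lower[OF mem[OF that] bdd])
  obtain c0 where c0: "c0 \<in> C" using C by blast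
  have ne: "V v \<noteq> {}" for v using mem[of 0 c0] c0 by blast
  have q_le: "q v \<le> p v" for v
    using le[of 0 c0 v] c0 by simp
  have q_neg: "q (- c) \<le> - d" if "c \<in> C" for c
    using le[of 1 c "- c"] that sublinear_zero[OF p] by simp
  have q_add: "q (x + y) \<le> q x + q y" for x y
  proof -
    have "q (x + y) \<le> r + s" if "r \<in> V x" and "s \<in> V y" for r s
    proof -
      obtain t c where tc: "0 \<le> t" "c \<in> C" "r = p (x + t *\<^sub>R c) - t * d"
        using \<open>r \<in> V x\<close> by (auto simp: V_def)
      obtain t' c' where tc': "0 \<le> t'" "c' \<in> C" "s = p (y + t' *\<^sub>R c') - t' * d"
        using \<open>s \<in> V y\<close> by (auto simp: V_def)
      \<comment> \<open>A nonnegative combination of two points of a convex set is a multiple of a third point of it.\<close>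
      obtain c'' where c'': "c'' \<in> C" "(t + t') *\<^sub>R c'' = t *\<^sub>R c + t' *\<^sub>R c'"
      proof (cases "t + t' = 0")
        case True
        then have "t = 0" "t' = 0" using tc(1) tc'(1) by auto
        then show ?thesis using that c0 by simp
      next
        case False
        define c'' where "c'' = (t / (t + t')) *\<^sub>R c + (t' / (t + t')) *\<^sub>R c'"
        have "c'' \<in> C"
          unfolding c''_def
          using False tc tc' by (intro convexD[OF C(1)]) (auto simp: add_divide_distrib[symmetric])
        moreover have "(t + t') *\<^sub>R c'' = t *\<^sub>R c + t' *\<^sub>R c'"
          using False by (simp add: c''_def scaleR_add_right)
        ultimately show ?thesis using that by blast
      qed
      have "q (x + y) \<le> p (x + y + (t + t') *\<^sub>R c'') - (t + t') * d"
        using c'' tc(1) tc'(1) by (intro le) auto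
      also have "x + y + (t + t') *\<^sub>R c'' = (x + t *\<^sub>R c) + (y + t' *\<^sub>R c')"
        by (simp add: c'')
      also have "p \<dots> \<le> p (x + t *\<^sub>R c) + p (y + t' *\<^sub>R c')"
        by (rule sublinear_add[OF p])
      finally show ?thesis
        using tc tc' by (simp add: algebra_simps)
    qed
    then have "q (x + y) - s \<le> q x" if "s \<in> V y" for s
      unfolding q_def[of x] using ne that by (intro cInf_greatest) (auto simp: algebra_simps)
    then have "q (x + y) - q x \<le> q y"
      unfolding q_def[of y] using ne by (intro cInf_greatest) (auto simp: algebra_simps)
    then show ?thesis by simp
  qed
  have q_scale: "q (t *\<^sub>R x) \<le> t * q x" if t: "0 < t" for t x
  proof -
    have "q (t *\<^sub>R x) / t \<le> r" if "r \<in> V x" for r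
    proof -
      obtain s c where sc: "0 \<le> s" "c \<in> C" "r = p (x + s *\<^sub>R c) - s * d"
        using \<open>r \<in> V x\<close> by (auto simp: V_def)
      have "q (t *\<^sub>R x) \<le> p (t *\<^sub>R x + (t * s) *\<^sub>R c) - (t * s) * d"
        using sc t by (intro le) auto
      also have "t *\<^sub>R x + (t * s) *\<^sub>R c = t *\<^sub>R (x + s *\<^sub>R c)"
        by (simp add: scaleR_add_right)
      also have "p \<dots> = t * p (x + s *\<^sub>R c)"
        using sublinear_scale[OF p] t by simp
      finally have "q (t *\<^sub>R x) \<le> t * r"
        by (simp add: sc(3) right_diff_distrib)
      then show ?thesis
        using t by (simp add: field_simps)
    qed
    then have "q (t *\<^sub>R x) / t \<le> q x"
      unfolding q_def[of x] using ne by (intro cInf_greatest)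
    then show ?thesis
      using t by (simp add: field_simps)
  qed
  have "q 0 = 0"
  proof (rule antisym)
    show "q 0 \<le> 0"
      using q_le[of 0] sublinear_zero[OF p] by simp
    show "0 \<le> q 0"
      unfolding q_def using low[of _ 0] sublinear_zero[OF p] by (intro cInf_greatest ne) simp
  qed
  then have "sublinear q"
    using q_add q_scale by (intro sublinear_of_pos)
  with q_le q_neg that show ?thesis by blast
qed

text \<open>
  Subadditivity survives the infimum because any two members of a chain, one used for \<open>x\<close> and the
  other for \<open>y\<close>, can be replaced by the smaller of the two. The bound \<open>p\<close> keeps the infimum finite,
  since \<open>- p (- v) \<le> - h (- v) \<le> h v\<close>.
\<close>

lemma sublinear_INF:
  assumes ne: "H \<noteq> {}" and sub: "\<And>h. h \<in> H \<Longrightarrow> sublinear h"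
    and chain: "\<And>h k. h \<in> H \<Longrightarrow> k \<in> H \<Longrightarrow> h \<le> k \<or> k \<le> h"
    and le: "\<And>h. h \<in> H \<Longrightarrow> h \<le> p"
  shows "sublinear (\<lambda>v. INF h\<in>H. h v)" and "\<And>h v. h \<in> H \<Longrightarrow> (INF h\<in>H. h v) \<le> h v"
proof -
  have low: "- p (- v) \<le> h v" if "h \<in> H" for h v
    using sublinear_ge_minus[OF sub[OF that], of v] le_funD[OF le[OF that], of "- v"] by simp
  then have bdd: "bdd_below ((\<lambda>h. h v) ` H)" for v
    by (auto intro!: bdd_belowI)
  show lower: "(INF h\<in>H. h v) \<le> h v" if "h \<in> H" for h v
    by (rule cINF_lower[OF bdd that])
  show "sublinear (\<lambda>v. INF h\<in>H. h v)"
  proof (rule sublinear_of_pos)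
    show "(INF h\<in>H. h 0) = 0"
    proof -
      have "(\<lambda>h. h 0) ` H = {0}"
        using ne sublinear_zero[OF sub] by (auto simp: image_iff intro: sym)
      then show ?thesis by simp
    qed
    fix t :: real and x :: 'a assume t: "0 < t"
    have "(INF h\<in>H. h (t *\<^sub>R x)) / t \<le> (INF h\<in>H. h x)"
    proof (rule cINF_greatest[OF ne])
      fix h assume h: "h \<in> H"
      then show "(INF h\<in>H. h (t *\<^sub>R x)) / t \<le> h x"
        using lower[OF h, of "t *\<^sub>R x"] sublinear_scale[OF sub[OF h], of t x] t
        by (simp add: field_simps)
    qed
    then show "(INF h\<in>H. h (t *\<^sub>R x)) \<le> t * (INF h\<in>H. h x)"
      using t by (simp add: field_simps)
  next
    fix x y
    have "(INF h\<in>H. h (x + y)) \<le> h x + k y" if h: "h \<in> H" and k: "k \<in> H" for h k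
    proof -
      have "(INF h\<in>H. h (x + y)) \<le> h x + h y"
        using lower[OF h] sublinear_add[OF sub[OF h]] by (rule order_trans)
      moreover have "(INF h\<in>H. h (x + y)) \<le> k x + k y"
        using lower[OF k] sublinear_add[OF sub[OF k]] by (rule order_trans)
      moreover have "h y \<le> k y \<or> k x \<le> h x"
        using chain[OF h k] by (auto dest: le_funD)
      ultimately show ?thesis by linarith
    qed
    then have "(INF h\<in>H. h (x + y)) - k y \<le> (INF h\<in>H. h x)" if "k \<in> H" for k
      using that by (intro cINF_greatest[OF ne]) (auto simp: algebra_simps)
    then have "(INF h\<in>H. h (x + y)) - (INF h\<in>H. h x) \<le> (INF h\<in>H. h y)"
      by (intro cINF_greatest[OF ne]) (auto simp: algebra_simps)
    then show "(INF h\<in>H. h (x + y)) \<le> (INF h\<in>H. h x) + (INF h\<in>H. h y)"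
      by simp
  qed
qed

text \<open>
  Reducing \<open>m\<close> along the singleton \<open>{x}\<close> with bound \<open>m x\<close> cannot change \<open>m\<close>, and this says that
  \<open>m (- x) \<le> - m x\<close>; an odd sublinear functional is linear.
\<close>

lemma linear_if_minimal_sublinear:
  assumes m: "sublinear m" and min: "\<And>q. sublinear q \<Longrightarrow> q \<le> m \<Longrightarrow> q = m"
  shows "linear m"
proof -
  have odd: "m (- x) = - m x" for x
  proof -
    obtain q where q: "sublinear q" "\<And>v. q v \<le> m v" "\<And>c. c \<in> {x} \<Longrightarrow> q (- c) \<le> - m x"
      using sublinear_reduction[OF m, of "{x}" "m x"] by auto
    then have "q = m" by (intro min) (auto simp: le_fun_def)
    with q(3) have "m (- x) \<le> - m x" by simp
    moreover have "- m x \<le> m (- x)"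
      using sublinear_ge_minus[OF m, of "- x"] by simp
    ultimately show ?thesis by simp
  qed
  show "linear m"
  proof (rule linearI)
    fix x y
    have "m (- x + - y) \<le> m (- x) + m (- y)"
      by (rule sublinear_add[OF m])
    then have "m x + m y \<le> m (x + y)"
      using odd[of "x + y"] odd by simp
    with sublinear_add[OF m] show "m (x + y) = m x + m y"
      by (simp add: antisym)
    fix r :: real
    show "m (r *\<^sub>R x) = r *\<^sub>R m x"
    proof (cases "0 \<le> r")
      case True
      then show ?thesis using sublinear_scale[OF m] by simp
    next
      case False
      then have "m ((- r) *\<^sub>R x) = (- r) * m x"
        by (intro sublinear_scale[OF m]) simp
      then show ?thesis using odd[of "r *\<^sub>R x"] by simp
    qed
  qed
qed

text \<open>
  Zorn's lemma gives a minimal sublinear functional below \<open>p\<close>. No subspace to extend from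
  appears: the constraints of a separation problem enter through \<open>p\<close>, by
  \<open>sublinear_reduction\<close>.
\<close>

theorem Hahn_Banach_sublinear:
  assumes p: "sublinear p"
  obtains \<phi> where "linear \<phi>" "\<And>v. \<phi> v \<le> p v"
proof -
  define A where "A = {q. sublinear q \<and> q \<le> p}"
  let ?R = "relation_of (\<lambda>q q'. q' \<le> q) A"
  have po: "partial_order_on A ?R"
    by (rule partial_order_on_relation_ofI) auto
  have ub: "\<exists>u\<in>A. \<forall>a\<in>H. u \<le> a" if H: "H \<in> Chains ?R" for H
  proof (cases "H = {}")
    case True
    then show ?thesis using p by (auto simp: A_def)
  next
    case False
    have HA: "h \<in> A" and ch: "h \<le> k \<or> k \<le> h" if "h \<in> H" "k \<in> H" for h k
      using H that by (auto simp: Chains_def relation_of_def)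
    have *: "sublinear (\<lambda>v. INF h\<in>H. h v)" "\<And>h v. h \<in> H \<Longrightarrow> (INF h\<in>H. h v) \<le> h v"
      using sublinear_INF[OF False, of p] HA ch by (auto simp: A_def)
    moreover have "(\<lambda>v. INF h\<in>H. h v) \<le> p"
    proof -
      obtain h where h: "h \<in> H" using False by blast
      then have "(\<lambda>v. INF h\<in>H. h v) \<le> h" using *(2) by (simp add: le_fun_def)
      also have "h \<le> p" using HA h by (simp add: A_def)
      finally show ?thesis .
    qed
    ultimately show ?thesis
      by (intro bexI[of _ "\<lambda>v. INF h\<in>H. h v"]) (auto simp: A_def le_fun_def)
  qed
  obtain m where m: "m \<in> A" "\<And>a. a \<in> A \<Longrightarrow> a \<le> m \<Longrightarrow> a = m"
    using predicate_Zorn[OF po ub] by blast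
  have "linear m"
  proof (rule linear_if_minimal_sublinear)
    show "sublinear m" using m by (simp add: A_def)
    show "q = m" if "sublinear q" "q \<le> m" for q
      using m that by (auto simp: A_def intro: order_trans)
  qed
  moreover have "m v \<le> p v" for v
    using m(1) by (simp add: A_def le_fun_def)
  ultimately show ?thesis by (rule that)
qed

text \<open>
  With \<open>C = S - x\<close> and \<open>d\<close> a lower bound for the distance from \<open>x\<close> to \<open>S\<close>, the reduction of the norm
  along \<open>C\<close> dominates a linear functional, which is then bounded by the norm and at least \<open>d\<close> on \<open>C\<close>.
\<close>

theorem strict_separation_closed_convex_point:
  fixes S :: "'a::real_normed_vector set"
  assumes S: "closed S" "convex S" and x: "x \<notin> S"
  shows "\<exists>\<phi> :: 'a \<Rightarrow>\<^sub>L real. \<exists>d>0. \<forall>y\<in>S. blinfun_apply \<phi> x + d \<le> blinfun_apply \<phi> y"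
proof (cases "S = {}")
  case True
  then show ?thesis using zero_less_one by blast
next
  case False
  obtain d where d: "0 < d" "\<And>y. y \<in> S \<Longrightarrow> d \<le> dist x y"
  proof -
    obtain d where "0 < d" "ball x d \<subseteq> - S"
      using S(1) x open_contains_ball[of "- S"] by auto
    then show ?thesis
      using that[of d] by (meson ComplD in_mono linorder_not_le mem_ball)
  qed
  define C where "C = (\<lambda>y. y - x) ` S"
  have "sublinear (norm :: 'a \<Rightarrow> real)"
    by (simp add: sublinear_def norm_triangle_ineq)
  moreover have "convex C" "C \<noteq> {}"
    using S False by (auto simp: C_def convex_translation_subtract)
  moreover have "d \<le> norm c" if "c \<in> C" for c
    using that d by (auto simp: C_def dist_norm norm_minus_commute)
  ultimately obtain q where q: "sublinear q" "\<And>v. q v \<le> norm v" "\<And>c. c \<in> C \<Longrightarrow> q (- c) \<le> - d"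
    using sublinear_reduction[of norm C d] by metis
  obtain \<phi> where \<phi>: "linear \<phi>" "\<And>v. \<phi> v \<le> q v"
    using Hahn_Banach_sublinear[OF q(1)] by blast
  have \<phi>_le: "\<phi> v \<le> norm v" for v
    using \<phi>(2)[of v] q(2)[of v] by simp
  have "\<bar>\<phi> v\<bar> \<le> norm v" for v
    using \<phi>_le[of v] \<phi>_le[of "- v"] linear_neg[OF \<phi>(1)] by (simp add: abs_le_iff)
  then have bl: "bounded_linear \<phi>"
    using \<phi>(1) by (intro bounded_linear_intro[where K = 1]) (auto simp: linear_add linear_scale)
  have "\<phi> x + d \<le> \<phi> y" if "y \<in> S" for y
  proof -
    have "\<phi> (- (y - x)) \<le> - d"
      using \<phi>(2)[of "- (y - x)"] q(3)[of "y - x"] that by (force simp: C_def)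
    then show ?thesis
      using linear_diff[OF \<phi>(1)] by simp
  qed
  then show ?thesis
    by (intro exI[of _ "Blinfun \<phi>"] exI[of _ d]) (simp add: bounded_linear_Blinfun_apply[OF bl] d(1))
qed

section \<open>The weak topology\<close>

lemma openin_weak_topology_imp_open:
  fixes U :: "'a::real_normed_vector set"
  assumes "openin weak_topology U"
  shows "open U"
proof -
  have "generate_topology_on {blinfun_apply \<phi> -` V | (\<phi> :: 'a \<Rightarrow>\<^sub>L real) V. open V} U"
    using assms by (simp add: weak_topology_def openin_topology_generated_by_iff)
  then show ?thesis
  proof induction
    case (Basis s)
    then show ?case
      by (auto intro!: open_vimage linear_continuous_on blinfun.bounded_linear_right)
  qed auto
qed

definition evaluations :: "'a::real_normed_vector \<Rightarrow> ('a \<Rightarrow>\<^sub>L real) \<Rightarrow> real" where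
  "evaluations x = (\<lambda>\<phi>. blinfun_apply \<phi> x)"

text \<open>
  The weak topology is the initial topology of the map \<open>evaluations\<close> into a product of real lines,
  so compactness can be checked on the image, where Tychonoff's theorem applies.
\<close>

lemma openin_weak_topology_vimage:
  fixes U :: "'a::real_normed_vector set"
  assumes "openin weak_topology U"
  shows "\<exists>W. open W \<and> U = evaluations -` W"
proof -
  have "generate_topology_on {blinfun_apply \<phi> -` V | (\<phi> :: 'a \<Rightarrow>\<^sub>L real) V. open V} U"
    using assms by (simp add: weak_topology_def openin_topology_generated_by_iff)
  then show ?thesis
  proof induction
    case Empty
    show ?case by (intro exI[of _ "{}"]) simp
  next
    case (Int a b)
    then obtain V W where "open V" "a = evaluations -` V" "open W" "b = evaluations -` W"
      by blast
    then show ?case by (intro exI[of _ "V \<inter> W"]) (simp add: open_Int)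
  next
    case (UN K)
    then obtain W where "\<And>k. k \<in> K \<Longrightarrow> open (W k) \<and> k = evaluations -` W k"
      by metis
    then show ?case by (intro exI[of _ "\<Union>k\<in>K. W k"]) (simp add: open_UN vimage_UN)
  next
    case (Basis s)
    then obtain \<phi> :: "'a \<Rightarrow>\<^sub>L real" and V where V: "open V" "s = blinfun_apply \<phi> -` V"
      by blast
    have "open ((\<lambda>h. h \<phi>) -` V)"
      by (intro open_vimage V continuous_on_product_coordinates)
    moreover have "s = evaluations -` ((\<lambda>h. h \<phi>) -` V)"
      by (auto simp: V evaluations_def)
    ultimately show ?case by blast
  qed
qed

lemma closedin_weak_topology_vimage:
  fixes S :: "'a::real_normed_vector set"
  assumes "closedin weak_topology S"
  obtains W where "closed W" "S = evaluations -` W"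
proof -
  obtain W where "open W" "UNIV - S = evaluations -` W"
    using openin_weak_topology_vimage[of "UNIV - S"] assms
    by (auto simp: closedin_def topspace_weak_topology)
  then show ?thesis
    by (intro that[of "- W"]) auto
qed

lemma compactin_weak_topology_if:
  assumes "compact (evaluations ` S)"
  shows "compactin weak_topology S"
  unfolding compactin_def
proof (intro conjI allI impI)
  show "S \<subseteq> topspace weak_topology" by (simp add: topspace_weak_topology)
  fix \<U> :: "'a set set" assume U: "Ball \<U> (openin weak_topology) \<and> S \<subseteq> \<Union>\<U>"
  then obtain W where W: "\<And>u. u \<in> \<U> \<Longrightarrow> open (W u) \<and> u = evaluations -` W u"
    using openin_weak_topology_vimage by metis
  have "evaluations ` S \<subseteq> (\<Union>u\<in>\<U>. W u)"
    using U W by blast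
  then obtain \<F> where "\<F> \<subseteq> \<U>" "finite \<F>" "evaluations ` S \<subseteq> (\<Union>u\<in>\<F>. W u)"
    using compactE_image[OF assms, of \<U> W] W by metis
  then show "\<exists>\<F>. finite \<F> \<and> \<F> \<subseteq> \<U> \<and> S \<subseteq> \<Union>\<F>"
    using W by (intro exI[of _ \<F>]) blast
qed

text \<open>
  Mazur's theorem: a separating functional provides a weakly open half space around each point outside.
\<close>

lemma closedin_weak_topology_closed_convex:
  fixes S :: "'a::real_normed_vector set"
  assumes "closed S" "convex S"
  shows "closedin weak_topology S"
proof -
  have "\<exists>T. openin weak_topology T \<and> x \<in> T \<and> T \<subseteq> - S" if x: "x \<notin> S" for x
  proof -
    obtain \<phi> :: "'a \<Rightarrow>\<^sub>L real" and d where d: "0 < d" "\<And>y. y \<in> S \<Longrightarrow> blinfun_apply \<phi> x + d \<le> blinfun_apply \<phi> y"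
      using strict_separation_closed_convex_point[OF assms x] by blast
    have "openin weak_topology (blinfun_apply \<phi> -` {..<blinfun_apply \<phi> x + d})"
      unfolding weak_topology_def
      by (intro topology_generated_by_Basis CollectI exI[of _ \<phi>]
          exI[of _ "{..<blinfun_apply \<phi> x + d}"] conjI refl open_lessThan)
    then show ?thesis
      using d by (intro exI[of _ "blinfun_apply \<phi> -` {..<blinfun_apply \<phi> x + d}"]) force
  qed
  then have "openin weak_topology (- S)"
    by (subst openin_subopen) auto
  then show ?thesis
    by (simp add: closedin_def topspace_weak_topology Compl_eq_Diff_UNIV)
qed

text \<open>
  The image of \<open>K\<close> under \<open>evaluations\<close> is the intersection of a compact box, of the closed set of
  linear functions on the dual, and of a closed set that cuts out \<open>K\<close>. Reflexivity enters exactly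
  once: a linear function in the box is a bounded functional on the dual, hence an evaluation.
\<close>

theorem compactin_weak_topology_closed_bounded_convex:
  fixes K :: "'a::real_normed_vector set"
  assumes refl: "reflexive_space TYPE('a)"
    and K: "bounded K" "closed K" "convex K"
  shows "compactin weak_topology K"
proof (rule compactin_weak_topology_if)
  obtain R where R: "\<And>x. x \<in> K \<Longrightarrow> norm x \<le> R"
    using K(1) by (auto simp: bounded_iff)
  obtain W where W: "closed W" "K = evaluations -` W"
    using closedin_weak_topology_vimage[OF closedin_weak_topology_closed_convex[OF K(2,3)]] by blast
  define box where "box = (PiE UNIV (\<lambda>\<phi> :: 'a \<Rightarrow>\<^sub>L real. {- (R * norm \<phi>)..R * norm \<phi>}))"
  define lin where "lin = {h :: ('a \<Rightarrow>\<^sub>L real) \<Rightarrow> real.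
    (\<forall>\<phi> \<psi>. h (\<phi> + \<psi>) = h \<phi> + h \<psi>) \<and> (\<forall>r \<phi>. h (r *\<^sub>R \<phi>) = r * h \<phi>)}"
  have box_iff: "h \<in> box \<longleftrightarrow> (\<forall>\<phi>. \<bar>h \<phi>\<bar> \<le> R * norm \<phi>)" for h
    by (simp add: box_def PiE_UNIV_domain Pi_iff abs_le_iff minus_le_iff conj_commute)
  have "compactin (product_topology (\<lambda>_. euclideanreal) UNIV) box"
    unfolding box_def by (subst compactin_PiE) auto
  then have box: "compact box"
    by (simp add: euclidean_product_topology)
  have lin: "closed lin"
    unfolding lin_def
    by (intro closed_Collect_conj closed_Collect_all closed_Collect_eq continuous_intros
        continuous_on_product_coordinates)
  have "evaluations ` K = box \<inter> (lin \<inter> W)"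
  proof (intro equalityI subsetI)
    fix h assume "h \<in> evaluations ` K"
    then obtain x where x: "x \<in> K" "h = evaluations x" by blast
    have "\<bar>blinfun_apply \<phi> x\<bar> \<le> R * norm \<phi>" for \<phi> :: "'a \<Rightarrow>\<^sub>L real"
    proof -
      have "\<bar>blinfun_apply \<phi> x\<bar> \<le> norm \<phi> * norm x"
        using norm_blinfun[of \<phi> x] by simp
      also have "\<dots> \<le> norm \<phi> * R"
        by (simp add: R x mult_left_mono)
      finally show ?thesis by (simp add: mult.commute)
    qed
    then show "h \<in> box \<inter> (lin \<inter> W)"
      using x W by (auto simp: box_iff lin_def evaluations_def blinfun.add_left blinfun.scaleR_left)
  next
    fix h assume h: "h \<in> box \<inter> (lin \<inter> W)"
    have bl: "bounded_linear h"
      by (rule bounded_linear_intro[where K = R])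
        (use h in \<open>auto simp: lin_def box_iff mult.commute\<close>)
    obtain x where x: "Blinfun h = canonical_embedding x"
      using refl unfolding reflexive_space_def by (metis surjD)
    have "h \<phi> = evaluations x \<phi>" for \<phi>
      using arg_cong[OF x, of "\<lambda>b. blinfun_apply b \<phi>"]
      by (simp add: bounded_linear_Blinfun_apply[OF bl] blinfun_apply_canonical_embedding evaluations_def)
    then have "h = evaluations x" by blast
    then show "h \<in> evaluations ` K"
      using h W by auto
  qed
  then show "compact (evaluations ` K)"
    using box lin W(1) by (simp add: compact_Int_closed closed_Int)
qed

section \<open>Semicontinuous functions\<close>

lemma upper_semicontinuous_map_iff_closedin:
  "upper_semicontinuous_map T h \<longleftrightarrow> (\<forall>a. closedin T {x \<in> topspace T. a \<le> h x})"
proof -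
  have "topspace T - {x \<in> topspace T. a \<le> h x} = {x \<in> topspace T. h x < a}" for a
    by auto
  then show ?thesis
    by (simp add: upper_semicontinuous_map_def closedin_def)
qed

lemma upper_semicontinuous_map_uminus:
  "upper_semicontinuous_map T (\<lambda>x. - h x) \<longleftrightarrow> lower_semicontinuous_map T h"
proof -
  have "{x \<in> topspace T. - h x < a} = {x \<in> topspace T. - a < h x}" for a
    by auto
  then show ?thesis
    unfolding upper_semicontinuous_map_def lower_semicontinuous_map_def
    by (metis minus_minus)
qed

lemma upper_semicontinuous_map_add:
  assumes h: "upper_semicontinuous_map T h" and k: "upper_semicontinuous_map T k"
  shows "upper_semicontinuous_map T (\<lambda>x. h x + k x)"
  unfolding upper_semicontinuous_map_def
proof
  fix a
  have "{x \<in> topspace T. h x + k x < a} =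
      (\<Union>r. {x \<in> topspace T. h x < r} \<inter> {x \<in> topspace T. k x < a - r})"
  proof (intro equalityI subsetI)
    fix x assume x: "x \<in> {x \<in> topspace T. h x + k x < a}"
    then obtain r where "h x < r" "r < a - k x"
      using dense[of "h x" "a - k x"] by force
    with x show "x \<in> (\<Union>r. {x \<in> topspace T. h x < r} \<inter> {x \<in> topspace T. k x < a - r})"
      by auto
  qed auto
  then show "openin T {x \<in> topspace T. h x + k x < a}"
    using h k by (auto simp: upper_semicontinuous_map_def intro!: openin_Union openin_Int)
qed

lemma upper_semicontinuous_map_compose:
  assumes "continuous_map S T f" and "upper_semicontinuous_map T h"
  shows "upper_semicontinuous_map S (\<lambda>x. h (f x))"
proof -
  have "{x \<in> topspace S. h (f x) < a} = {x \<in> topspace S. f x \<in> {y \<in> topspace T. h y < a}}" for a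
    using continuous_map_image_subset_topspace[OF assms(1)] by auto
  moreover have "openin S {x \<in> topspace S. f x \<in> {y \<in> topspace T. h y < a}}" for a
    using assms(2) by (intro openin_continuous_map_preimage[OF assms(1)])
      (simp add: upper_semicontinuous_map_def)
  ultimately show ?thesis
    unfolding upper_semicontinuous_map_def by metis
qed

lemma upper_semicontinuous_map_continuous:
  "continuous_on UNIV h \<Longrightarrow> upper_semicontinuous_map euclidean h"
  by (simp add: upper_semicontinuous_map_def open_Collect_less)

text \<open>
  Superlevel sets of a concave function are convex, so for them norm closed and weakly closed agree.
\<close>

lemma upper_semicontinuous_map_weak_topology_concave:
  assumes "upper_semicontinuous_map euclidean h" and conc: "concave_on UNIV h"
  shows "upper_semicontinuous_map weak_topology h"
  unfolding upper_semicontinuous_map_iff_closedin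
proof
  fix a
  have "closed {x. a \<le> h x}"
    using assms(1) by (simp add: upper_semicontinuous_map_iff_closedin)
  moreover have "convex {x. a \<le> h x}"
  proof (rule convexI)
    fix x y and s t :: real assume *: "x \<in> {x. a \<le> h x}" "y \<in> {x. a \<le> h x}" "0 \<le> s" "0 \<le> t" "s + t = 1"
    have "a = s * a + t * a"
      using * by (metis distrib_right mult_1)
    also have "\<dots> \<le> s * h x + t * h y"
      using * by (intro add_mono mult_left_mono) auto
    also have "\<dots> \<le> h (s *\<^sub>R x + t *\<^sub>R y)"
      using conc * by (auto simp: concave_on_iff)
    finally show "s *\<^sub>R x + t *\<^sub>R y \<in> {x. a \<le> h x}" by simp
  qed
  ultimately show "closedin weak_topology {x \<in> topspace weak_topology. a \<le> h x}"
    by (simp add: topspace_weak_topology closedin_weak_topology_closed_convex)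
qed

section \<open>The structure conditions\<close>

text \<open>
  On the slice \<open>lam = \<mu>\<close> the function \<open>2 B u \<mu> - B u lam\<close> of (i) equals \<open>B u \<mu>\<close>, and on a slice
  \<open>u = const\<close> it is \<open>- B u lam\<close> up to a constant; weakly open sets are open, which gives both
  semicontinuity statements. The slices of the function in (ii) give convexity and concavity in the
  same way.
\<close>

lemma cond_B2_imp_cond_B1:
  fixes B :: "'a::real_normed_vector \<Rightarrow> 'b::real_normed_vector \<Rightarrow> real"
  assumes "cond_B2 B"
  shows "cond_B1 B"
proof -
  have conc: "concave_on UNIV (\<lambda>(u, lam). 2 * B v lam - B u lam)" for v
    using assms by (simp add: cond_B2_def)
  have "open {p. a < (\<lambda>(u, lam). 2 * B u \<mu> - B u lam) p}" for a \<mu>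
    using assms openin_weak_topology_imp_open
    by (auto simp: cond_B2_def lower_semicontinuous_map_def topspace_weak_topology)
  then have opn: "open ((\<lambda>x. (p x, q x)) -` {p. a < (\<lambda>(u, lam). 2 * B u \<mu> - B u lam) p})"
    if "continuous_on UNIV p" "continuous_on UNIV q"
    for a \<mu> and p :: "'c::real_normed_vector \<Rightarrow> 'a" and q :: "'c \<Rightarrow> 'b"
    using that by (intro open_vimage continuous_on_Pair) auto
  show ?thesis
    unfolding cond_B1_def
  proof (intro conjI allI)
    fix lam
    have "convex_on UNIV (\<lambda>u. B u lam)"
    proof (rule convex_onI)
      fix t :: real and x y assume "0 < t" "t < 1"
      have "(1 - t) * (2 * B 0 lam - B x lam) + t * (2 * B 0 lam - B y lam)
          \<le> 2 * B 0 ((1 - t) *\<^sub>R lam + t *\<^sub>R lam) - B ((1 - t) *\<^sub>R x + t *\<^sub>R y) ((1 - t) *\<^sub>R lam + t *\<^sub>R lam)"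
        using concave_onD[OF conc[of 0], of t "(x, lam)" "(y, lam)"] \<open>0 < t\<close> \<open>t < 1\<close> by simp
      moreover have "(1 - t) *\<^sub>R lam + t *\<^sub>R lam = lam"
        by (simp add: scaleR_left_diff_distrib)
      ultimately show "B ((1 - t) *\<^sub>R x + t *\<^sub>R y) lam \<le> (1 - t) * B x lam + t * B y lam"
        by (simp add: algebra_simps)
    qed simp
    then show "convex_on UNIV (\<lambda>u. B u lam)" .
    show "lower_semicontinuous_map euclidean (\<lambda>u. B u lam)"
      using opn[of "\<lambda>u. u" "\<lambda>_. lam" _ lam] by (simp add: lower_semicontinuous_map_def vimage_def)
  next
    fix u
    show "concave_on UNIV (\<lambda>lam. B u lam)"
        unfolding concave_on_def
    proof (rule convex_onI)
      fix t :: real and x y assume "0 < t" "t < 1"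
      have "(1 - t) * (2 * B u x - B u x) + t * (2 * B u y - B u y)
          \<le> 2 * B u ((1 - t) *\<^sub>R x + t *\<^sub>R y) - B ((1 - t) *\<^sub>R u + t *\<^sub>R u) ((1 - t) *\<^sub>R x + t *\<^sub>R y)"
        using concave_onD[OF conc[of u], of t "(u, x)" "(u, y)"] \<open>0 < t\<close> \<open>t < 1\<close> by simp
      moreover have "(1 - t) *\<^sub>R u + t *\<^sub>R u = u"
        by (simp add: scaleR_left_diff_distrib)
      ultimately show "- B u ((1 - t) *\<^sub>R x + t *\<^sub>R y) \<le> (1 - t) * - B u x + t * - B u y"
        by (simp add: algebra_simps)
    qed simp
    have "open {lam. B u lam < a}" for a
      using opn[of "\<lambda>_. u" "\<lambda>lam. lam" "2 * B u 0 - a" 0] by (simp add: vimage_def)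
    then show "upper_semicontinuous_map euclidean (\<lambda>lam. B u lam)"
      by (simp add: upper_semicontinuous_map_def)
  qed
qed

lemma convex_on_affine_compose:
  assumes "linear L" and h: "convex_on UNIV h"
  shows "convex_on UNIV (\<lambda>x. h (c + L x))"
proof (rule convex_onI)
  fix t :: real and x y assume t: "0 < t" "t < 1"
  have "c + L ((1 - t) *\<^sub>R x + t *\<^sub>R y) = (1 - t) *\<^sub>R (c + L x) + t *\<^sub>R (c + L y)"
    unfolding linear_add[OF assms(1)] linear_scale[OF assms(1)] by (simp add: algebra_simps)
  then show "h (c + L ((1 - t) *\<^sub>R x + t *\<^sub>R y)) \<le> (1 - t) * h (c + L x) + t * h (c + L y)"
    using convex_onD[OF h, of t "c + L x" "c + L y"] t by simp
qed simp

text \<open>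
  The surrogate \<open>\<Phi> v u\<close> of \<open>chi u (v - u)\<close> is \<open>chi u (v - u)\<close> itself under (X1) and Minty's
  \<open>chi v (v - u)\<close> under (X2). The first property is what the compactness argument needs. The convex
  minorants in the third property drive the KKM argument; under (X2) the minorant is
  \<open>- chi u (u - v)\<close>, and it lies below by monotonicity. The last property returns from the surrogate
  to \<open>chi\<close> in the presence of any convex \<open>b\<close>, for which \<open>L\<close> with one argument fixed will be taken.
\<close>

lemma Minty_resolvent:
  assumes chi: "cond_XP1 chi \<or> cond_XP2 chi"
  obtains \<Phi> :: "'a::real_normed_vector \<Rightarrow> 'a \<Rightarrow> real" where
    "\<And>v. upper_semicontinuous_map weak_topology (\<Phi> v)"
    "\<And>u. \<Phi> u u = 0"
    "\<And>u. \<exists>k. convex_on UNIV k \<and> k u = 0 \<and> (\<forall>v. k v \<le> \<Phi> v u)"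
    "\<And>K b u. convex K \<Longrightarrow> convex_on UNIV b \<Longrightarrow> u \<in> K \<Longrightarrow> (\<And>v. v \<in> K \<Longrightarrow> 0 \<le> b v - b u + \<Phi> v u)
      \<Longrightarrow> (\<And>v. v \<in> K \<Longrightarrow> 0 \<le> b v - b u + chi u (v - u))"
  using chi
proof
  assume X1: "cond_XP1 chi"
  show thesis
  proof (rule that[of "\<lambda>v u. chi u (v - u)"])
    show "\<exists>k. convex_on UNIV k \<and> k u = 0 \<and> (\<forall>v. k v \<le> chi u (v - u))" for u
      using X1 convex_on_affine_compose[of "\<lambda>v. v" "chi u" "- u"]
      by (intro exI[of _ "\<lambda>v. chi u (v - u)"]) (simp add: cond_XP1_def linear_ident)
  qed (use X1 in \<open>auto simp: cond_XP1_def\<close>)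
next
  assume X2: "cond_XP2 chi"
  have conc: "convex_on UNIV (\<lambda>v. - chi u v)" for u
    using X2 by (simp add: cond_XP2_def concave_on_def)
  have lin_uminus: "linear (\<lambda>v :: 'a. - v)"
    by (simp add: linear_iff)
  show thesis
  proof (rule that[of "\<lambda>v u. chi v (v - u)"])
    fix v
    have "concave_on UNIV (\<lambda>u. chi v (v - u))"
      using convex_on_affine_compose[OF lin_uminus conc, of v v] by (simp add: concave_on_def)
    moreover have "upper_semicontinuous_map euclidean (\<lambda>u. chi v (v - u))"
    proof (rule upper_semicontinuous_map_compose[where T = euclidean and h = "chi v"])
      show "continuous_map euclidean euclidean (\<lambda>u. v - u)"
        by (intro continuous_intros) (simp add: continuous_on_diff)
      show "upper_semicontinuous_map euclidean (chi v)"
        using X2 by (simp add: cond_XP2_def)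
    qed
    ultimately show "upper_semicontinuous_map weak_topology (\<lambda>u. chi v (v - u))"
      by (simp add: upper_semicontinuous_map_weak_topology_concave)
  next
    fix u
    have "chi v (v - u) \<ge> - chi u (u - v)" for v
      using X2 unfolding cond_XP2_def by (smt (verit))
    then show "\<exists>k. convex_on UNIV k \<and> k u = 0 \<and> (\<forall>v. k v \<le> chi v (v - u))"
      using X2 convex_on_affine_compose[OF lin_uminus conc, of u u]
      by (intro exI[of _ "\<lambda>v. - chi u (u - v)"]) (simp add: cond_XP2_def)
    show "chi u (u - u) = 0"
      using X2 by (simp add: cond_XP2_def)
  next
    fix K and b :: "'a \<Rightarrow> real" and u w
    assume K: "convex K" and b: "convex_on UNIV b" and u: "u \<in> K"
      and ineq: "\<And>v. v \<in> K \<Longrightarrow> 0 \<le> b v - b u + chi v (v - u)" and w: "w \<in> K"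
    \<comment> \<open>Minty's trick: test at points of the segment from \<open>u\<close> to \<open>w\<close>, divide by \<open>t\<close>, and let \<open>t\<close> tend to \<open>0\<close>.\<close>
    define p where "p t = u + t *\<^sub>R (w - u)" for t :: real
    have "0 \<le> b w - b u + chi (p t) (w - u)" if t: "0 < t" "t < 1" for t
    proof -
      have p_eq: "p t = (1 - t) *\<^sub>R u + t *\<^sub>R w"
        by (simp add: p_def algebra_simps)
      have "p t \<in> K"
        unfolding p_eq using K u w t by (intro convexD) auto
      then have "0 \<le> b (p t) - b u + chi (p t) (t *\<^sub>R (w - u))"
        using ineq[of "p t"] by (simp add: p_def)
      also have "chi (p t) (t *\<^sub>R (w - u)) = t * chi (p t) (w - u)"
        using X2 t by (simp add: cond_XP2_def positive_homogeneous_def)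
      also have "b (p t) \<le> (1 - t) * b u + t * b w"
        unfolding p_eq using convex_onD[OF b] t by simp
      finally have "0 \<le> t * (b w - b u + chi (p t) (w - u))"
        by (simp add: algebra_simps)
      then show ?thesis
        using t by (simp add: zero_le_mult_iff)
    qed
    then have "eventually (\<lambda>t. 0 \<le> b w - b u + chi (p t) (w - u)) (at_right 0)"
      unfolding eventually_at_right[OF zero_less_one] by (intro exI[of _ 1]) auto
    moreover have "((\<lambda>t. b w - b u + chi (p t) (w - u)) \<longlongrightarrow> b w - b u + chi u (w - u)) (at_right 0)"
      using X2 unfolding p_def by (intro tendsto_intros) (simp add: cond_XP2_def)
    ultimately show "0 \<le> b w - b u + chi u (w - u)"
      by (intro tendsto_lowerbound) auto
  qed
qed

section \<open>Existence\<close>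

lemma closedin_prod_weak_topology_imp_closed:
  fixes S :: "('a::real_normed_vector \<times> 'b::real_normed_vector) set"
  assumes "closedin (prod_topology weak_topology weak_topology) S"
  shows "closed S"
proof -
  have "openin (prod_topology weak_topology weak_topology) (- S)"
    using assms by (simp add: closedin_def topspace_weak_topology Compl_eq_Diff_UNIV)
  then have "open (- S)"
    unfolding openin_prod_topology_alt open_prod_def
    by (metis SigmaI openin_weak_topology_imp_open surj_pair)
  then show ?thesis by (simp add: closed_def)
qed

text \<open>
  The minorants \<open>G\<close> replace the usual assumption that \<open>F\<close> is quasi-convex in its first argument: if
  \<open>x\<close> is in the convex hull of points \<open>z\<close> with \<open>F z x < 0\<close>, then it is in the convex set
  \<open>{z. G z < 0}\<close>, against \<open>G x = 0\<close>. So the sets \<open>{x. 0 \<le> F z x}\<close> satisfy the covering hypothesis of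
  the KKM principle.
\<close>

lemma Ky_Fan_weak_product:
  fixes K :: "'a::real_normed_vector set" and \<Lambda> :: "'b::real_normed_vector set"
    and F :: "'a \<times> 'b \<Rightarrow> 'a \<times> 'b \<Rightarrow> real"
  assumes K: "compactin weak_topology K" "K \<noteq> {}" "convex K"
    and \<Lambda>: "compactin weak_topology \<Lambda>" "\<Lambda> \<noteq> {}" "convex \<Lambda>"
    and usc: "\<And>z. upper_semicontinuous_map (prod_topology weak_topology weak_topology) (F z)"
    and minorant: "\<And>x. \<exists>G. convex_on UNIV G \<and> G x = 0 \<and> (\<forall>z. G z \<le> F z x)"
  shows "\<exists>x\<in>K \<times> \<Lambda>. \<forall>z\<in>K \<times> \<Lambda>. 0 \<le> F z x"
proof -
  let ?T = "prod_topology (weak_topology :: 'a topology) (weak_topology :: 'b topology)"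
  define M where "M z = {x. 0 \<le> F z x}" for z
  have M: "closedin ?T (M z)" for z
    using usc[of z] by (simp add: M_def upper_semicontinuous_map_iff_closedin topspace_weak_topology)
  have fip: "K \<times> \<Lambda> \<inter> \<Inter>\<F> \<noteq> {}" if \<F>: "finite \<F>" "\<F> \<subseteq> M ` (K \<times> \<Lambda>)" for \<F>
  proof -
    obtain A where A: "A \<subseteq> K \<times> \<Lambda>" "finite A" "\<F> = M ` A"
      using finite_subset_image[OF \<F>] by blast
    show ?thesis
    proof (cases "A = {}")
      case True
      then show ?thesis using A K(2) \<Lambda>(2) by simp
    next
      case False
      have cover: "convex hull S \<subseteq> (\<Union>a\<in>S. M a)" for S
      proof
        fix x assume x: "x \<in> convex hull S"
        show "x \<in> (\<Union>a\<in>S. M a)"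
        proof (rule ccontr)
          assume "x \<notin> (\<Union>a\<in>S. M a)"
          then have neg: "F z x < 0" if "z \<in> S" for z
            using that by (auto simp: M_def)
          obtain G where G: "convex_on UNIV G" "G x = 0" "\<And>z. G z \<le> F z x"
            using minorant by blast
          have "convex {z. G z < 0}"
          proof (rule convexI)
            fix y z and s t :: real
            assume *: "y \<in> {z. G z < 0}" "z \<in> {z. G z < 0}" "0 \<le> s" "0 \<le> t" "s + t = 1"
            have "G (s *\<^sub>R y + t *\<^sub>R z) \<le> s * G y + t * G z"
              using G(1) * unfolding convex_on_def by blast
            also have "\<dots> < 0"
              using * by (intro convex_bound_lt) auto
            finally show "s *\<^sub>R y + t *\<^sub>R z \<in> {z. G z < 0}" by simp
          qed
          moreover have "S \<subseteq> {z. G z < 0}"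
            using neg le_less_trans[OF G(3)] by blast
          ultimately have "convex hull S \<subseteq> {z. G z < 0}"
            by (intro hull_minimal)
          then show False
            using x G(2) by auto
        qed
      qed
      obtain x where x: "x \<in> convex hull A" "\<forall>a\<in>A. x \<in> M a"
        using KKM[OF A(2) False, of M] cover closedin_prod_weak_topology_imp_closed[OF M] by blast
      have "convex hull A \<subseteq> K \<times> \<Lambda>"
        using A(1) K(3) \<Lambda>(3) by (intro hull_minimal convex_Times)
      then show ?thesis
        using x A(3) by auto
    qed
  qed
  have "compactin ?T (K \<times> \<Lambda>)"
    using K(1) \<Lambda>(1) by (simp add: compactin_Times)
  then have "(\<forall>C\<in>\<U>. closedin ?T C) \<Longrightarrow> (\<forall>\<F>. finite \<F> \<and> \<F> \<subseteq> \<U> \<longrightarrow> K \<times> \<Lambda> \<inter> \<Inter>\<F> \<noteq> {})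
      \<Longrightarrow> K \<times> \<Lambda> \<inter> \<Inter>\<U> \<noteq> {}" for \<U>
    by (simp add: compactin_fip)
  from this[of "M ` (K \<times> \<Lambda>)"] have "K \<times> \<Lambda> \<inter> \<Inter>(M ` (K \<times> \<Lambda>)) \<noteq> {}"
    using M fip by simp
  then show ?thesis
    by (auto simp: M_def)
qed

theorem lemma2p2:
  fixes K :: "'a::banach set" and \<Lambda> :: "'b::banach set"
    and B :: "'a \<Rightarrow> 'b \<Rightarrow> real"
    and chi :: "'a \<Rightarrow> 'a \<Rightarrow> real"
    and \<psi> :: "'b \<Rightarrow> 'b \<Rightarrow> real"
    and f :: "'a \<Rightarrow>\<^sub>L real" and g :: "'b \<Rightarrow>\<^sub>L real"
  assumes "reflexive_space TYPE('a)" and "reflexive_space TYPE('b)"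
    and "K \<noteq> {}" and "bounded K" and "closed K" and "convex K"
    and "\<Lambda> \<noteq> {}" and "bounded \<Lambda>" and "closed \<Lambda>" and "convex \<Lambda>"
    and "cond_B1 B \<or> cond_B2 B"
    and "cond_XP1 chi \<or> cond_XP2 chi"
    and "cond_XP1 \<psi> \<or> cond_XP2 \<psi>"
  shows "\<exists>u\<in>K. \<exists>lam\<in>\<Lambda>.
    (\<forall>v\<in>K. B v lam - B u lam + chi u (v - u) \<ge> blinfun_apply f (v - u)) \<and>
    (\<forall>\<mu>\<in>\<Lambda>. B u lam - B u \<mu> + \<psi> lam (\<mu> - lam) \<ge> blinfun_apply g (\<mu> - lam))"
proof -
  have B1: "cond_B1 B"
    using assms(11) cond_B2_imp_cond_B1 by blast
  define L where "L u lam = B u lam - blinfun_apply f u + blinfun_apply g lam" for u lam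
  have L_convex: "convex_on UNIV (\<lambda>u. L u lam)" for lam
  proof -
    have "convex_on UNIV (\<lambda>u. B u lam + (- blinfun_apply f u + blinfun_apply g lam))"
    proof (rule convex_on_add)
      show "convex_on UNIV (\<lambda>u. - blinfun_apply f u + blinfun_apply g lam)"
        by (rule convex_onI, simp_all only: blinfun.add_right blinfun.scaleR_right convex_UNIV)
          (simp add: algebra_simps)
    qed (use B1 in \<open>simp add: cond_B1_def\<close>)
    then show ?thesis by (simp add: L_def algebra_simps)
  qed
  have L_concave: "convex_on UNIV (\<lambda>lam. - L u lam)" for u
  proof -
    have "convex_on UNIV (\<lambda>lam. - B u lam + (blinfun_apply f u - blinfun_apply g lam))"
    proof (rule convex_on_add)
      show "convex_on UNIV (\<lambda>lam. blinfun_apply f u - blinfun_apply g lam)"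
        by (rule convex_onI, simp_all only: blinfun.add_right blinfun.scaleR_right convex_UNIV)
          (simp add: algebra_simps)
    qed (use B1 in \<open>simp add: cond_B1_def concave_on_def\<close>)
    then show ?thesis by (simp add: L_def algebra_simps)
  qed
  have L_usc1: "upper_semicontinuous_map weak_topology (\<lambda>u. - L u lam)" for lam
  proof (rule upper_semicontinuous_map_weak_topology_concave)
    have "upper_semicontinuous_map euclidean (\<lambda>u. - B u lam + (blinfun_apply f u - blinfun_apply g lam))"
    proof (rule upper_semicontinuous_map_add)
      show "upper_semicontinuous_map euclidean (\<lambda>u. - B u lam)"
        using B1 by (simp add: cond_B1_def upper_semicontinuous_map_uminus)
    qed (intro upper_semicontinuous_map_continuous continuous_intros)
    then show "upper_semicontinuous_map euclidean (\<lambda>u. - L u lam)"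
      by (simp add: L_def algebra_simps)
    show "concave_on UNIV (\<lambda>u. - L u lam)"
      using L_convex by (simp add: concave_on_def)
  qed
  have L_usc2: "upper_semicontinuous_map weak_topology (\<lambda>lam. L u lam)" for u
  proof (rule upper_semicontinuous_map_weak_topology_concave)
    have "upper_semicontinuous_map euclidean (\<lambda>lam. B u lam + (- blinfun_apply f u + blinfun_apply g lam))"
    proof (rule upper_semicontinuous_map_add)
      show "upper_semicontinuous_map euclidean (\<lambda>lam. B u lam)"
        using B1 by (simp add: cond_B1_def)
    qed (intro upper_semicontinuous_map_continuous continuous_intros)
    then show "upper_semicontinuous_map euclidean (\<lambda>lam. L u lam)"
      by (simp add: L_def algebra_simps)
    show "concave_on UNIV (\<lambda>lam. L u lam)"
      using L_concave by (simp add: concave_on_def)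
  qed
  obtain \<Phi> where \<Phi>_usc: "\<And>v. upper_semicontinuous_map weak_topology (\<Phi> v)"
    and \<Phi>_diag: "\<And>u. \<Phi> u u = 0"
    and \<Phi>_minorant: "\<And>u. \<exists>k. convex_on UNIV k \<and> k u = 0 \<and> (\<forall>v. k v \<le> \<Phi> v u)"
    and \<Phi>_back: "\<And>K b u v. convex K \<Longrightarrow> convex_on UNIV b \<Longrightarrow> u \<in> K \<Longrightarrow>
      (\<And>v. v \<in> K \<Longrightarrow> 0 \<le> b v - b u + \<Phi> v u) \<Longrightarrow> v \<in> K \<Longrightarrow> 0 \<le> b v - b u + chi u (v - u)"
    using Minty_resolvent[OF assms(12)] by metis
  obtain \<Psi> where \<Psi>_usc: "\<And>v. upper_semicontinuous_map weak_topology (\<Psi> v)"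
    and \<Psi>_diag: "\<And>u. \<Psi> u u = 0"
    and \<Psi>_minorant: "\<And>u. \<exists>k. convex_on UNIV k \<and> k u = 0 \<and> (\<forall>v. k v \<le> \<Psi> v u)"
    and \<Psi>_back: "\<And>K b u v. convex K \<Longrightarrow> convex_on UNIV b \<Longrightarrow> u \<in> K \<Longrightarrow>
      (\<And>v. v \<in> K \<Longrightarrow> 0 \<le> b v - b u + \<Psi> v u) \<Longrightarrow> v \<in> K \<Longrightarrow> 0 \<le> b v - b u + \<psi> u (v - u)"
    using Minty_resolvent[OF assms(13)] by metis
  define F where "F z x = (L (fst z) (snd x) + - L (fst x) (snd z)) + (\<Phi> (fst z) (fst x) + \<Psi> (snd z) (snd x))"
    for z x
  have "\<exists>x\<in>K \<times> \<Lambda>. \<forall>z\<in>K \<times> \<Lambda>. 0 \<le> F z x"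
  proof (rule Ky_Fan_weak_product)
    show "compactin weak_topology K" "compactin weak_topology \<Lambda>"
      using assms compactin_weak_topology_closed_bounded_convex by blast+
  next
    fix z
    show "upper_semicontinuous_map (prod_topology weak_topology weak_topology) (F z)"
      unfolding F_def
      by (intro upper_semicontinuous_map_add
          upper_semicontinuous_map_compose[OF continuous_map_fst L_usc1]
          upper_semicontinuous_map_compose[OF continuous_map_snd L_usc2]
          upper_semicontinuous_map_compose[OF continuous_map_fst \<Phi>_usc]
          upper_semicontinuous_map_compose[OF continuous_map_snd \<Psi>_usc])
  next
    fix x :: "'a \<times> 'b"
    obtain k where k: "convex_on UNIV k" "k (fst x) = 0" "\<And>v. k v \<le> \<Phi> v (fst x)"
      using \<Phi>_minorant by blast
    obtain l where l: "convex_on UNIV l" "l (snd x) = 0" "\<And>v. l v \<le> \<Psi> v (snd x)"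
      using \<Psi>_minorant by blast
    define G where "G z = (L (fst z) (snd x) + - L (fst x) (snd z)) + (k (fst z) + l (snd z))" for z
    have fst: "convex_on UNIV (\<lambda>z :: 'a \<times> 'b. h (fst z))" if "convex_on UNIV h" for h :: "'a \<Rightarrow> real"
      using convex_on_affine_compose[OF linear_fst that, of 0] by simp
    have snd: "convex_on UNIV (\<lambda>z :: 'a \<times> 'b. h (snd z))" if "convex_on UNIV h" for h :: "'b \<Rightarrow> real"
      using convex_on_affine_compose[OF linear_snd that, of 0] by simp
    have "convex_on UNIV G"
      unfolding G_def
      by (intro convex_on_add fst[OF L_convex] snd[OF L_concave] fst[OF k(1)] snd[OF l(1)])
    moreover have "G x = 0" by (simp add: G_def k l)
    moreover have "G z \<le> F z x" for z
      using k(3) l(3) by (simp add: G_def F_def add_mono)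
    ultimately show "\<exists>G. convex_on UNIV G \<and> G x = 0 \<and> (\<forall>z. G z \<le> F z x)" by blast
  qed (use assms in auto)
  then obtain u lam where ul: "u \<in> K" "lam \<in> \<Lambda>"
    and F: "\<And>v \<mu>. v \<in> K \<Longrightarrow> \<mu> \<in> \<Lambda> \<Longrightarrow> 0 \<le> F (v, \<mu>) (u, lam)"
    by auto
  have 1: "0 \<le> L v lam - L u lam + chi u (v - u)" if "v \<in> K" for v
    using F[OF _ ul(2)]
    by (intro \<Phi>_back[OF assms(6) L_convex ul(1) _ that]) (simp add: F_def \<Psi>_diag)
  have 2: "0 \<le> - L u \<mu> - - L u lam + \<psi> lam (\<mu> - lam)" if "\<mu> \<in> \<Lambda>" for \<mu>
    using F[OF ul(1)]
    by (intro \<Psi>_back[OF assms(10) L_concave ul(2) _ that]) (simp add: F_def \<Phi>_diag)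
  show ?thesis
  proof (rule bexI[OF _ ul(1)], rule bexI[OF _ ul(2)], intro conjI ballI)
    fix v assume "v \<in> K"
    then show "blinfun_apply f (v - u) \<le> B v lam - B u lam + chi u (v - u)"
      using 1[of v] by (simp add: L_def blinfun.diff_right)
  next
    fix \<mu> assume "\<mu> \<in> \<Lambda>"
    then show "blinfun_apply g (\<mu> - lam) \<le> B u lam - B u \<mu> + \<psi> lam (\<mu> - lam)"
      using 2[of \<mu>] by (simp add: L_def blinfun.diff_right)
  qed
qed

end
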